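(* There is an online algorithm that 2-colors the edges arriving in the first $1.06n$ rounds of the online random edge process on $n$ vertices such that, with high probability, every connected component in each of the two color classes has order $O(\log n)$.
   Context: Online random edge process: there are $n$ vertices and a sequence of rounds; in each round one edge arrives, chosen uniformly at random among all pairs of distinct vertices, independently of previous rounds (repetitions are possible). The algorithm must color each edge upon arrival, using only the history so far. "With high probability" means with probability tending to $1$ as $n\to\infty$. *)

theory Defs
  imports "HOL-Probability.Probability"
begin

datatype color = Red | Blue

type_synonym edge = "nat set"

text \<open>
  An online algorithm sees the coloured edges of all earlier rounds, oldest first, and the edge
  that has just arrived, and returns the colour of that edge.
\<close>

type_synonym online_algorithm = "(edge \<times> color) list \<Rightarrow> edge \<Rightarrow> color"

definition run :: "online_algorithm \<Rightarrow> edge list \<Rightarrow> (edge \<times> color) list" where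
  "run A es = foldl (\<lambda>h e. h @ [(e, A h e)]) [] es"

text \<open>
  An edge that arrives in several rounds may be given both colours, and then lies in both
  colour classes.
\<close>

definition color_class :: "(edge \<times> color) list \<Rightarrow> color \<Rightarrow> edge set" where
  "color_class h c = {e. (e, c) \<in> set h}"

definition all_pairs :: "nat \<Rightarrow> edge set" where
  "all_pairs n = {e. e \<subseteq> {..<n} \<and> card e = 2}"

text \<open>
  The first \<open>m\<close> rounds of the process on the vertex set \<open>{..<n}\<close>; only meaningful for
  \<open>n \<ge> 2\<close>, as \<open>pmf_of_set\<close> is unspecified on the empty set.
\<close>

definition edge_process :: "nat \<Rightarrow> nat \<Rightarrow> edge list pmf" where
  "edge_process n m = replicate_pmf m (pmf_of_set (all_pairs n))"

definition connected_in :: "nat set \<Rightarrow> edge set \<Rightarrow> (nat \<times> nat) set" where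
  "connected_in V E = {(x, y) \<in> V \<times> V. (x, y) \<in> {(u, v). {u, v} \<in> E}\<^sup>*}"

text \<open>The vertex sets of the connected components, isolated vertices included.\<close>

definition graph_components :: "nat set \<Rightarrow> edge set \<Rightarrow> nat set set" where
  "graph_components V E = V // connected_in V E"

end

theory Submission
  imports Defs
begin

text \<open>
  The first \<open>m = 0.49995 n\<close> edges are all coloured red, which leaves the red graph subcritical and
  about \<open>n / e\<close> vertices isolated. Fix a set \<open>I\<close> of \<open>k = 0.3678 n\<close> isolated vertices. A later edge is
  red if it lies inside \<open>I\<close> and blue otherwise. The red edges inside \<open>I\<close> do not meet the earlier red
  edges and are subcritical, because \<open>k\<close> is small. The blue edges form a two-type random graph on
  \<open>I\<close> and its complement; its branching matrix for \<open>b n\<close> edges is \<open>2 b\<close> times the matrix with rows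
  \<open>(0, q)\<close> and \<open>(p, q)\<close>, where \<open>p = 0.3678\<close> and \<open>q = 1 - p\<close>, and it has spectral radius below 1
  for \<open>b = 0.56005\<close>.

  Component sizes of such a subcritical graph have exponential moments: exploring one vertex after
  the other, a product of weights over the active vertices is a supermartingale when the edges are
  independent. The independence comes from replacing the \<open>m\<close> rounds by a Poisson number of rounds
  with mean \<open>m\<close>; conditioning on the value \<open>m\<close> costs only a factor linear in \<open>m\<close>, harmless next to
  the exponential tail.
\<close>

subsection \<open>Exploration with independent edges\<close>

text \<open>\<open>U\<close> is the set of unexplored vertices: walks start in \<open>A\<close>,
  take at least one step, and every vertex after the start lies in \<open>U\<close>. Members of
  \<open>A\<close> outside \<open>U\<close> are therefore not counted.\<close>

definition reach :: "'a set set \<Rightarrow> 'a set \<Rightarrow> 'a set \<Rightarrow> 'a set" where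
  "reach S A U = {(x, y). {x, y} \<in> S \<and> y \<in> U}\<^sup>+ `` A"

lemma reach_subset: "reach S A U \<subseteq> U"
  unfolding reach_def by (auto elim: tranclE)

lemma finite_reach: "finite U \<Longrightarrow> finite (reach S A U)"
  using reach_subset by (rule finite_subset)

lemma reach_empty [simp]: "reach S {} U = {}"
  unfolding reach_def by simp

lemma reach_step:
  assumes "x \<in> A \<union> reach S A U" "{x, y} \<in> S" "y \<in> U"
  shows "y \<in> reach S A U"
  using assms unfolding reach_def by (auto intro: trancl_into_trancl)

lemma reach_induct [consumes 1, case_names step]:
  assumes "x \<in> reach S A U"
    and "\<And>x y. x \<in> A \<or> P x \<Longrightarrow> {x, y} \<in> S \<Longrightarrow> y \<in> U \<Longrightarrow> P y"
  shows "P x"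
proof -
  obtain a where "a \<in> A" "(a, x) \<in> {(x, y). {x, y} \<in> S \<and> y \<in> U}\<^sup>+"
    using assms(1) unfolding reach_def by auto
  from this(2,1) show ?thesis
    by (induction rule: trancl_induct) (use assms(2) in auto)
qed

lemma reach_explore:
  assumes "a \<in> A" "A \<inter> U = {}"
  shows "reach S A U \<subseteq> {u \<in> U. {a, u} \<in> S} \<union>
    reach (S - {{a, u} | u. u \<in> U}) (A - {a} \<union> {u \<in> U. {a, u} \<in> S}) (U - {u. {a, u} \<in> S})"
    (is "_ \<subseteq> ?N \<union> reach ?S ?A ?U")
proof
  fix x assume "x \<in> reach S A U"
  then show "x \<in> ?N \<union> reach ?S ?A ?U"
  proof (induction rule: reach_induct)
    case (step x y)
    show ?case
    proof (cases "x = a \<or> y \<in> ?N")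
      case True
      with step show ?thesis by auto
    next
      case False
      have "x \<in> ?A \<union> reach ?S ?A ?U" using step False by auto
      moreover have "{x, y} \<in> ?S"
        using step False assms by (auto simp: doubleton_eq_iff)
      moreover have "y \<in> ?U" using step False by auto
      ultimately have "y \<in> reach ?S ?A ?U" by (rule reach_step)
      then show ?thesis ..
    qed
  qed
qed

section \<open>Weighted sums over edge sets\<close>

lemma sum_Pow_disjoint_union:
  fixes f :: "'a set \<Rightarrow> 'b::comm_monoid_add"
  assumes "finite D" "finite G" "D \<inter> G = {}"
  shows "(\<Sum>S\<in>Pow (D \<union> G). f S) = (\<Sum>T\<in>Pow D. \<Sum>S\<in>Pow G. f (T \<union> S))"
proof -
  have "(\<Sum>T\<in>Pow D. \<Sum>S\<in>Pow G. f (T \<union> S)) = (\<Sum>(T, S)\<in>Pow D \<times> Pow G. f (T \<union> S))"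
    by (rule sum.cartesian_product)
  also have "\<dots> = (\<Sum>S\<in>Pow (D \<union> G). f S)"
    by (rule sum.reindex_bij_witness[where i = "\<lambda>S. (S \<inter> D, S \<inter> G)" and j = "\<lambda>(T, S). T \<union> S"])
      (use assms in auto)
  finally show ?thesis by simp
qed

text \<open>This is the normalising constant when each element is present independently with odds
  \<open>y\<close>, that is with probability \<open>y / (1 + y)\<close>. The exploration argument
  works with these unnormalised weights.\<close>

lemma sum_Pow_power_card:
  fixes y :: "'b::comm_semiring_1"
  assumes "finite A"
  shows "(\<Sum>S\<in>Pow A. y ^ card S) = (1 + y) ^ card A"
  using prod_add[OF assms, of "\<lambda>_. y" "\<lambda>_. 1"] by (simp add: add.commute)

text \<open>
  Exposing the edges from \<open>a\<close> to \<open>U\<close> replaces the active vertex \<open>a\<close> by its neighbours in \<open>U\<close>;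
  the hypothesis on \<open>h\<close> says that this does not increase the expected product of \<open>h\<close> over the
  active vertices.
\<close>

lemma sum_exp_reach_le:
  fixes h :: "'a \<Rightarrow> real" and y z :: real
  assumes "finite A" "finite U" "A \<inter> U = {}" "finite F" "y \<ge> 0" "z \<ge> 1" "\<And>u. h u \<ge> 1"
    and "\<And>a M. finite M \<Longrightarrow> a \<notin> M \<Longrightarrow> (\<And>u. u \<in> M \<Longrightarrow> {a, u} \<in> F) \<Longrightarrow>
           (\<Prod>u\<in>M. 1 + y * z * h u) \<le> (1 + y) ^ card M * h a"
  shows "(\<Sum>S\<in>Pow F. y ^ card S * z ^ card (reach S A U)) \<le> (1 + y) ^ card F * (\<Prod>a\<in>A. h a)"
  using assms
\<comment> \<open>Processing an active vertex deletes it and moves its neighbours from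
  \<open>U\<close> to \<open>A\<close>, so this sum drops by exactly one.\<close>
proof (induction "card A + card U" arbitrary: A U F)
  case 0
  then have "A = {}" by simp
  then show ?case using 0 by (simp add: sum_Pow_power_card)
next
  case (Suc k)
  show ?case
  proof (cases "A = {}")
    case True
    then show ?thesis using Suc.prems by (simp add: sum_Pow_power_card)
  next
    case False
    then obtain a where a: "a \<in> A" by auto
    define M where "M = {u \<in> U. {a, u} \<in> F}"
    \<comment> \<open>\<open>D\<close> holds the potential edges exposed when \<open>a\<close> is
      processed; those in \<open>G\<close> stay unexposed and go to the induction
      hypothesis.\<close>
    define D where "D = (\<lambda>u. {a, u}) ` M"
    define G where "G = F - D"
    have fin: "finite M" "finite D" "finite G"
      using Suc.prems(2,4) unfolding M_def D_def G_def by auto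
    have aU: "a \<notin> U" using a Suc.prems(3) by auto
    have inj: "inj_on (\<lambda>u. {a, u}) M"
      by (auto intro!: inj_onI simp: doubleton_eq_iff)
    have F: "F = D \<union> G" "D \<inter> G = {}" unfolding G_def D_def M_def by auto
    have cardF: "card F = card M + card G"
      using F fin inj by (simp add: card_Un_disjoint D_def card_image)
    define P where "P = (\<Prod>a\<in>A - {a}. h a)"
    have P0: "P \<ge> 0" unfolding P_def
      by (intro prod_nonneg) (use Suc.prems(7) order_trans[OF zero_le_one] in blast)
    have h0: "h u \<ge> 0" for u using Suc.prems(7)[of u] by simp
    \<comment> \<open>The contribution of all outcomes in which the neighbours of \<open>a\<close>
      in \<open>U\<close> are exactly \<open>N\<close>.\<close>
    have inner: "(\<Sum>S\<in>Pow G. y ^ card (((\<lambda>u. {a, u}) ` N) \<union> S) * z ^ card (reach (((\<lambda>u. {a, u}) ` N) \<union> S) A U))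
         \<le> (1 + y) ^ card G * P * (\<Prod>u\<in>N. y * z * h u)"
      if N: "N \<subseteq> M" for N
    proof -
      let ?T = "(\<lambda>u. {a, u}) ` N"
      have finN: "finite N" using N fin finite_subset by blast
      have NU: "N \<subseteq> U" using N unfolding M_def by auto
      have "(\<Sum>S\<in>Pow G. y ^ card (?T \<union> S) * z ^ card (reach (?T \<union> S) A U))
          \<le> (\<Sum>S\<in>Pow G. (y * z) ^ card N * (y ^ card S * z ^ card (reach S (A - {a} \<union> N) (U - N))))"
      proof (rule sum_mono)
        fix S assume S: "S \<in> Pow G"
        have finS: "finite S" using S fin finite_subset by blast
        have disj: "?T \<inter> S = {}" using S N F unfolding D_def by auto
        have c: "card (?T \<union> S) = card N + card S"
          using disj finN finS inj_on_subset[OF inj N] by (simp add: card_Un_disjoint card_image)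
        have nb: "{u \<in> U. {a, u} \<in> ?T \<union> S} = N"
          using NU S unfolding G_def D_def M_def by (auto simp: doubleton_eq_iff)
        have rest: "?T \<union> S - {{a, u} | u. u \<in> U} = S"
          using NU S unfolding G_def D_def M_def by (auto simp: doubleton_eq_iff)
        have U: "U - {u. {a, u} \<in> ?T \<union> S} = U - N" using nb by auto
        have "reach (?T \<union> S) A U \<subseteq> N \<union> reach S (A - {a} \<union> N) (U - N)"
          using reach_explore[OF a Suc.prems(3), of "?T \<union> S"] unfolding nb rest U .
        then have "card (reach (?T \<union> S) A U) \<le> card (N \<union> reach S (A - {a} \<union> N) (U - N))"
          by (rule card_mono[rotated])
            (use finN Suc.prems(2) in \<open>auto intro: finite_reach\<close>)
        also have "\<dots> \<le> card N + card (reach S (A - {a} \<union> N) (U - N))"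
          by (rule card_Un_le)
        finally have "z ^ card (reach (?T \<union> S) A U) \<le>
            z ^ card N * z ^ card (reach S (A - {a} \<union> N) (U - N))"
          using Suc.prems(6) by (simp add: power_increasing flip: power_add)
        then show "y ^ card (?T \<union> S) * z ^ card (reach (?T \<union> S) A U) \<le>
            (y * z) ^ card N * (y ^ card S * z ^ card (reach S (A - {a} \<union> N) (U - N)))"
          unfolding c using Suc.prems(5)
          by (simp add: power_add power_mult_distrib mult_left_mono mult_ac)
      qed
      also have "\<dots> = (y * z) ^ card N * (\<Sum>S\<in>Pow G. y ^ card S * z ^ card (reach S (A - {a} \<union> N) (U - N)))"
        by (simp add: sum_distrib_left)
      also have "\<dots> \<le> (y * z) ^ card N * ((1 + y) ^ card G * (\<Prod>a\<in>A - {a} \<union> N. h a))"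
      proof (rule mult_left_mono)
        show "(\<Sum>S\<in>Pow G. y ^ card S * z ^ card (reach S (A - {a} \<union> N) (U - N)))
           \<le> (1 + y) ^ card G * (\<Prod>a\<in>A - {a} \<union> N. h a)"
        proof (rule Suc.hyps(1))
          have "card (A - {a} \<union> N) = card (A - {a}) + card N"
            by (intro card_Un_disjoint) (use Suc.prems(1-3) finN NU in auto)
          moreover have "card (U - N) = card U - card N"
            using finN NU by (simp add: card_Diff_subset)
          moreover have "card N \<le> card U" using NU Suc.prems(2) card_mono by blast
          moreover have "card A = Suc (card (A - {a}))"
            using a Suc.prems(1) card.remove by fastforce
          ultimately show "k = card (A - {a} \<union> N) + card (U - N)"
            using Suc.hyps(2) by linarith
          show "(A - {a} \<union> N) \<inter> (U - N) = {}" using Suc.prems(3) by auto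
          show "(\<Prod>u\<in>M. 1 + y * z * h u) \<le> (1 + y) ^ card M * h a"
            if "finite M" "a \<notin> M" "\<And>u. u \<in> M \<Longrightarrow> {a, u} \<in> G" for a M
            by (rule Suc.prems(8)) (use that F in auto)
          show "finite (A - {a} \<union> N)" "finite (U - N)" using Suc.prems(1,2) finN by auto
        qed (fact fin Suc.prems)+
        show "0 \<le> (y * z) ^ card N" using Suc.prems(5,6) by simp
      qed
      also have "(\<Prod>a\<in>A - {a} \<union> N. h a) = P * (\<Prod>u\<in>N. h u)"
        unfolding P_def by (intro prod.union_disjoint) (use Suc.prems(1-3) finN NU in auto)
      finally show ?thesis by (simp add: prod.distrib power_mult_distrib mult_ac)
    qed
    have "(\<Sum>S\<in>Pow F. y ^ card S * z ^ card (reach S A U)) =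
      (\<Sum>T\<in>Pow D. \<Sum>S\<in>Pow G. y ^ card (T \<union> S) * z ^ card (reach (T \<union> S) A U))"
      unfolding F(1) by (rule sum_Pow_disjoint_union) (use fin F in auto)
    also have "\<dots> = (\<Sum>N\<in>Pow M. \<Sum>S\<in>Pow G.
        y ^ card (((\<lambda>u. {a, u}) ` N) \<union> S) * z ^ card (reach (((\<lambda>u. {a, u}) ` N) \<union> S) A U))"
    proof (rule sum.reindex_cong)
      show "inj_on (image (\<lambda>u. {a, u})) (Pow M)"
        using inj by (rule inj_on_image_Pow)
      show "Pow D = image (\<lambda>u. {a, u}) ` Pow M"
        unfolding D_def by (rule image_Pow_surj[symmetric]) simp
    qed simp
    also have "\<dots> \<le> (\<Sum>N\<in>Pow M. (1 + y) ^ card G * P * (\<Prod>u\<in>N. y * z * h u))"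
      by (rule sum_mono) (use inner in auto)
    \<comment> \<open>Each candidate in \<open>M\<close> is either a neighbour, with factor
      \<open>y * z * h u\<close>, or not, with factor 1; so the sum over \<open>N\<close> is a
      product, which the hypothesis on \<open>h\<close> bounds.\<close>
    also have "\<dots> = (1 + y) ^ card G * P * (\<Prod>u\<in>M. y * z * h u + 1)"
      using prod_add[OF fin(1), of "\<lambda>u. y * z * h u" "\<lambda>_. 1"] by (simp add: sum_distrib_left)
    also have "\<dots> = (1 + y) ^ card G * P * (\<Prod>u\<in>M. 1 + y * z * h u)"
      by (simp add: add.commute)
    also have "\<dots> \<le> (1 + y) ^ card G * P * ((1 + y) ^ card M * h a)"
      by (intro mult_left_mono Suc.prems(8)) (use fin aU P0 Suc.prems(5) in \<open>auto simp: M_def\<close>)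
    also have "\<dots> = (1 + y) ^ card F * (\<Prod>a\<in>A. h a)"
      unfolding cardF P_def using a Suc.prems(1) by (simp add: power_add prod.remove mult_ac)
    finally show ?thesis .
  qed
qed

subsection \<open>Poissonisation\<close>

text \<open>This is the exponential generating function of surjections onto \<open>S\<close>. If
  every element arrives a Poisson number of times with mean \<open>x\<close>, arrivals are
  independent, and having each element arrive at least once gives a factor \<open>exp x - 1\<close>
  per element.\<close>

lemma sums_card_lists_with_set:
  fixes x :: real
  assumes "finite S"
  shows "(\<lambda>m. x ^ m / fact m * card {es. set es = S \<and> length es = m}) sums (exp x - 1) ^ card S"
  using assms
proof (induction S rule: finite_psubset_induct)
  case (psubset S)
  let ?g = "\<lambda>T m. x ^ m / fact m * real (card {es. set es = T \<and> length es = m})"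
  have fin: "finite {es. set es = T \<and> length es = m}" if "T \<subseteq> S" for T and m :: nat
    by (rule finite_subset[OF _ finite_lists_length_eq[OF \<open>finite S\<close>, of m]]) (use that in auto)
  \<comment> \<open>Words over \<open>S\<close>, grouped by the set \<open>T\<close> of letters that
    occur, have the series of \<open>exp (x * card S)\<close>. The induction hypothesis removes
    every proper subset \<open>T\<close>, and the binomial theorem identifies what remains.\<close>
  have all: "(\<Sum>T\<in>Pow S. ?g T m) = (x * card S) ^ m /\<^sub>R fact m" for m
  proof -
    have "card {es. set es \<subseteq> S \<and> length es = m} = card (\<Union>T\<in>Pow S. {es. set es = T \<and> length es = m})"
      by (rule arg_cong[where f = card]) auto
    also have "\<dots> = (\<Sum>T\<in>Pow S. card {es. set es = T \<and> length es = m})"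
      by (rule card_UN_disjoint) (use \<open>finite S\<close> fin in auto)
    finally have "real (card S ^ m) = real (\<Sum>T\<in>Pow S. card {es. set es = T \<and> length es = m})"
      unfolding card_lists_length_eq[OF \<open>finite S\<close>] by (rule arg_cong)
    then have "real (card S) ^ m = (\<Sum>T\<in>Pow S. real (card {es. set es = T \<and> length es = m}))"
      by (simp only: of_nat_sum of_nat_power)
    then show ?thesis
      by (simp add: power_mult_distrib divide_inverse sum_distrib_left mult_ac)
  qed
  have "(\<lambda>m. \<Sum>T\<in>Pow S. ?g T m) sums exp (x * card S)"
    unfolding all by (rule exp_converges)
  moreover have "(\<lambda>m. \<Sum>T\<in>Pow S - {S}. ?g T m) sums (\<Sum>T\<in>Pow S - {S}. (exp x - 1) ^ card T)"
    by (rule sums_sum) (use psubset in auto)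
  ultimately have "(\<lambda>m. (\<Sum>T\<in>Pow S. ?g T m) - (\<Sum>T\<in>Pow S - {S}. ?g T m)) sums
      (exp (x * card S) - (\<Sum>T\<in>Pow S - {S}. (exp x - 1) ^ card T))"
    by (rule sums_diff)
  moreover have "(\<Sum>T\<in>Pow S. ?g T m) - (\<Sum>T\<in>Pow S - {S}. ?g T m) = ?g S m" for m
    using \<open>finite S\<close> by (subst sum.remove[of _ S]) auto
  moreover have "exp (x * card S) = (\<Sum>T\<in>Pow S. (exp x - 1) ^ card T)"
    using \<open>finite S\<close> by (simp add: sum_Pow_power_card exp_of_nat2_mult)
  then have "exp (x * card S) - (\<Sum>T\<in>Pow S - {S}. (exp x - 1) ^ card T) = (exp x - 1) ^ card S"
    using \<open>finite S\<close> by (simp add: sum.remove[of _ S])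
  ultimately show ?case by simp
qed

text \<open>A series of nonnegative terms is at least its \<open>m\<close>-th term. Hence exactly
  \<open>m\<close> rounds are dominated by independent elements with odds \<open>exp x - 1\<close>,
  at the cost of the factor \<open>fact m / x ^ m\<close>.\<close>

lemma sum_lists_le_sum_sets:
  fixes f :: "'a set \<Rightarrow> real" and x :: real
  assumes "finite R" "x > 0" "\<And>S. f S \<ge> 0"
  shows "(\<Sum>es | set es \<subseteq> R \<and> length es = m. f (set es)) \<le>
    fact m / x ^ m * (\<Sum>S\<in>Pow R. (exp x - 1) ^ card S * f S)"
proof -
  have fin: "finite {es. set es \<subseteq> R \<and> length es = m}"
    using finite_lists_length_eq[OF assms(1), of m] .
  have le: "real (card {es. set es = S \<and> length es = m}) \<le> fact m / x ^ m * (exp x - 1) ^ card S"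
    if "S \<subseteq> R" for S
  proof -
    have s: "(\<lambda>m. x ^ m / fact m * card {es. set es = S \<and> length es = m}) sums (exp x - 1) ^ card S"
      using sums_card_lists_with_set finite_subset[OF that assms(1)] by blast
    have "x ^ m / fact m * card {es. set es = S \<and> length es = m} \<le> (exp x - 1) ^ card S"
      using sum_le_suminf[OF sums_summable[OF s], of "{m}"] sums_unique[OF s] assms(2) by simp
    then show ?thesis using assms(2) by (simp add: field_simps)
  qed
  have "(\<Sum>es | set es \<subseteq> R \<and> length es = m. f (set es)) =
      (\<Sum>S\<in>Pow R. \<Sum>es\<in>{es \<in> {es. set es \<subseteq> R \<and> length es = m}. set es = S}. f (set es))"
    by (rule sum.group[symmetric]) (use fin assms in auto)
  also have "\<dots> = (\<Sum>S\<in>Pow R. card {es. set es = S \<and> length es = m} * f S)"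
  proof (rule sum.cong[OF refl])
    fix S assume "S \<in> Pow R"
    then have "{es \<in> {es. set es \<subseteq> R \<and> length es = m}. set es = S} = {es. set es = S \<and> length es = m}"
      by auto
    then show "(\<Sum>es\<in>{es \<in> {es. set es \<subseteq> R \<and> length es = m}. set es = S}. f (set es)) =
      card {es. set es = S \<and> length es = m} * f S" by simp
  qed
  also have "\<dots> \<le> (\<Sum>S\<in>Pow R. fact m / x ^ m * (exp x - 1) ^ card S * f S)"
    by (intro sum_mono mult_right_mono le assms(3)) auto
  finally show ?thesis by (simp add: sum_distrib_left mult_ac)
qed

text \<open>A weak Stirling bound: a Poisson variable with mean \<open>m\<close> takes the value
  \<open>m\<close> with probability at least \<open>1 / (exp 1 * m)\<close>. This is the linear
  price of conditioning on the number of rounds.\<close>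

lemma fact_le_exp_bound:
  assumes "m \<ge> 1"
  shows "fact m * exp (real m) \<le> exp 1 * real m * real m ^ m"
  using assms
proof (induction m rule: nat_induct_at_least)
  case base
  then show ?case by simp
next
  case (Suc m)
  \<comment> \<open>The induction step amounts to e \<le> (1 + 1/m)^(m+1), obtained from
    \<open>exp (- ?x) \<ge> 1 - ?x\<close>.\<close>
  let ?x = "1 / (real m + 1)"
  have m: "real m > 0" using Suc by simp
  have "exp (- ?x) \<ge> 1 - ?x" using exp_ge_add_one_self[of "- ?x"] by simp
  then have "exp (- ?x) ^ (m + 1) \<ge> (1 - ?x) ^ (m + 1)" by (intro power_mono) auto
  also have "exp (- ?x) ^ (m + 1) = exp (real (m + 1) * (- ?x))"
    by (rule exp_of_nat_mult[symmetric])
  also have "real (m + 1) * (- ?x) = -1" using m by (simp add: field_simps)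
  finally have "(1 - ?x) ^ (m + 1) \<le> exp (-1)" .
  moreover have "1 - ?x = m / (real m + 1)" using m by (simp add: field_simps)
  ultimately have "m ^ (m + 1) / (real m + 1) ^ (m + 1) \<le> exp (-1)"
    by (simp add: power_divide)
  then have key: "exp 1 * real m ^ (m + 1) \<le> (real m + 1) ^ (m + 1)"
    using m by (simp add: divide_simps exp_minus mult.commute)
  have "fact (Suc m) * exp (real (Suc m)) = (real m + 1) * exp 1 * (fact m * exp (real m))"
    by (simp add: exp_add algebra_simps)
  also have "\<dots> \<le> (real m + 1) * exp 1 * (exp 1 * real m * real m ^ m)"
    by (intro mult_left_mono Suc.IH) auto
  also have "\<dots> = (real m + 1) * exp 1 * (exp 1 * real m ^ (m + 1))" by simp
  also have "\<dots> \<le> (real m + 1) * exp 1 * (real m + 1) ^ (m + 1)"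
    by (intro mult_left_mono key) auto
  finally show ?case by (simp add: algebra_simps)
qed

subsection \<open>Component sizes in the edge process\<close>

lemma expectation_replicate_pmf_of_set:
  fixes f :: "'a list \<Rightarrow> real"
  assumes "finite R" "R \<noteq> {}"
  shows "measure_pmf.expectation (replicate_pmf m (pmf_of_set R)) f =
    (\<Sum>es | set es \<subseteq> R \<and> length es = m. f es) / card R ^ m"
proof (induction m arbitrary: f)
  case 0
  have "{es. set es \<subseteq> R \<and> length es = 0} = {[]}" by auto
  then show ?case by simp
next
  case (Suc m)
  let ?L = "\<lambda>m. {es. set es \<subseteq> R \<and> length es = m}"
  let ?rep = "\<lambda>m. replicate_pmf m (pmf_of_set R)"
  have "replicate_pmf (Suc m) (pmf_of_set R) = pmf_of_set R \<bind> (\<lambda>x. map_pmf ((#) x) (?rep m))"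
    by (simp add: map_pmf_def)
  then have "measure_pmf.expectation (?rep (Suc m)) f =
      (\<Sum>x\<in>R. measure_pmf.expectation (map_pmf ((#) x) (?rep m)) f /\<^sub>R card R)"
    using assms finite_lists_length_eq[OF assms(1), of m]
    by (simp only:, subst pmf_expectation_bind_pmf_of_set)
      (auto simp: set_replicate_pmf lists_eq_set)
  also have "\<dots> = (\<Sum>x\<in>R. \<Sum>es\<in>?L m. f (x # es)) / card R ^ Suc m"
    unfolding integral_map_pmf Suc.IH by (simp add: sum_divide_distrib divide_inverse sum_distrib_left mult_ac)
  also have "(\<Sum>x\<in>R. \<Sum>es\<in>?L m. f (x # es)) = (\<Sum>(x, es)\<in>R \<times> ?L m. f (x # es))"
    by (rule sum.cartesian_product)
  also have "\<dots> = (\<Sum>es\<in>?L (Suc m). f es)"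
    by (rule sum.reindex_bij_witness[where i = "\<lambda>es. (hd es, tl es)" and j = "\<lambda>(x, es). x # es"])
      (auto simp: length_Suc_conv)
  finally show ?case .
qed

lemma finite_set_replicate_pmf_of_set:
  assumes "finite R" "R \<noteq> {}"
  shows "finite (set_pmf (replicate_pmf m (pmf_of_set R)))"
  using assms finite_lists_length_eq[OF assms(1), of m]
  by (simp add: set_replicate_pmf lists_eq_set)

text \<open>A Chernoff bound: the exploration bound with \<open>z = exp s\<close> and
  \<open>h u = exp (g u)\<close> controls the exponential moment of the explored size, and Markov's
  inequality turns it into a tail. The hypothesis \<open>sub\<close> expresses subcriticality,
  \<open>x\<close> being the mean number of arrivals of one pair.\<close>

lemma reach_tail:
  fixes g :: "'a \<Rightarrow> real" and s t x :: real
  assumes R: "finite R" "R \<noteq> {}" "F \<subseteq> R" and m: "m \<ge> 1" and x: "x = real m / card R"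
    and U: "finite U" "v \<notin> U" and s: "s \<ge> 0" and g: "\<And>u. g u \<ge> 0"
    and sub: "\<And>a M. finite M \<Longrightarrow> a \<notin> M \<Longrightarrow> (\<And>u. u \<in> M \<Longrightarrow> {a, u} \<in> F) \<Longrightarrow>
           (\<Sum>u\<in>M. x * (exp (s + g u) - 1)) \<le> g a"
  shows "measure_pmf.prob (replicate_pmf m (pmf_of_set R)) {es. t \<le> card (reach (set es \<inter> F) {v} U)}
    \<le> exp 1 * m * exp (g v - s * t)"
proof -
  let ?p = "replicate_pmf m (pmf_of_set R)"
  let ?X = "\<lambda>S. card (reach (S \<inter> F) {v} U)"
  \<comment> \<open>The odds that a pair with a Poisson number of arrivals of mean \<open>x\<close>
    arrives at least once.\<close>
  define y where "y = exp x - 1"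
  have cR: "card R > 0" using R by (simp add: card_gt_0_iff)
  have x0: "x > 0" using m cR unfolding x by simp
  then have y0: "y \<ge> 0" unfolding y_def by simp
  have finF: "finite F" using R finite_subset by blast
  have prod: "(\<Prod>u\<in>M. 1 + y * exp s * exp (g u)) \<le> (1 + y) ^ card M * exp (g a)"
    if M: "finite M" "a \<notin> M" "\<And>u. u \<in> M \<Longrightarrow> {a, u} \<in> F" for a M
  proof -
    \<comment> \<open>After division by \<open>1 + y\<close> the edge probability is 1 - exp(-x)
      \<le> x; then 1 + t \<le> exp t makes the product an exponential of the sum in
      \<open>sub\<close>.\<close>
    have "(\<Prod>u\<in>M. 1 + y * exp s * exp (g u)) \<le> (\<Prod>u\<in>M. (1 + y) * exp (x * (exp (s + g u) - 1)))"
    proof (rule prod_mono, safe)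
      fix u
      let ?c = "exp (s + g u) - 1"
      have c: "?c \<ge> 0" using s g[of u] by simp
      have "exp (- x) \<ge> 1 - x" using exp_ge_add_one_self[of "- x"] by simp
      then have "(1 - exp (- x)) * ?c \<le> x * ?c" using c by (intro mult_right_mono) auto
      moreover have "1 + x * ?c \<le> exp (x * ?c)" by (rule exp_ge_add_one_self)
      ultimately have "exp x * (1 + (1 - exp (- x)) * ?c) \<le> exp x * exp (x * ?c)"
        by (intro mult_left_mono) (linarith, simp)
      moreover have "exp x * (1 + (1 - exp (- x)) * ?c) = 1 + y * exp s * exp (g u)"
        unfolding y_def by (simp add: algebra_simps exp_minus exp_add)
      ultimately show "1 + y * exp s * exp (g u) \<le> (1 + y) * exp (x * ?c)"
        unfolding y_def by simp
      show "0 \<le> 1 + y * exp s * exp (g u)" using y0 by simp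
    qed
    also have "\<dots> = (1 + y) ^ card M * exp (\<Sum>u\<in>M. x * (exp (s + g u) - 1))"
      using M(1) by (simp add: prod.distrib exp_sum)
    also have "\<dots> \<le> (1 + y) ^ card M * exp (g a)"
      using sub[OF M] y0 by (intro mult_left_mono) auto
    finally show ?thesis .
  qed
  have "(\<Sum>S\<in>Pow R. y ^ card S * exp s ^ ?X S) =
      (\<Sum>S\<in>Pow (F \<union> (R - F)). y ^ card S * exp s ^ ?X S)"
    using R by (simp add: Un_absorb1)
  also have "\<dots> = (\<Sum>D\<in>Pow F. \<Sum>G\<in>Pow (R - F). y ^ card (D \<union> G) * exp s ^ ?X (D \<union> G))"
    by (rule sum_Pow_disjoint_union) (use R finF in auto)
  also have "\<dots> = (\<Sum>D\<in>Pow F. \<Sum>G\<in>Pow (R - F). (y ^ card D * exp s ^ card (reach D {v} U)) * y ^ card G)"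
  proof (intro sum.cong refl)
    fix D G assume DG: "D \<in> Pow F" "G \<in> Pow (R - F)"
    then have "(D \<union> G) \<inter> F = D" by auto
    moreover have "card (D \<union> G) = card D + card G"
      using DG finF R finite_subset by (intro card_Un_disjoint) blast+
    ultimately show "y ^ card (D \<union> G) * exp s ^ ?X (D \<union> G) =
        (y ^ card D * exp s ^ card (reach D {v} U)) * y ^ card G"
      by (simp add: power_add)
  qed
  \<comment> \<open>Pairs outside \<open>F\<close> do not influence the explored set and sum to
    their own normalising constant.\<close>
  also have "\<dots> = (\<Sum>D\<in>Pow F. y ^ card D * exp s ^ card (reach D {v} U)) * (1 + y) ^ card (R - F)"
    using R by (simp add: sum_distrib_left[symmetric] sum_Pow_power_card sum_distrib_right)
  also have "\<dots> \<le> ((1 + y) ^ card F * (\<Prod>a\<in>{v}. exp (g a))) * (1 + y) ^ card (R - F)"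
  proof (intro mult_right_mono sum_exp_reach_le)
    show "(\<Prod>u\<in>M. 1 + y * exp s * exp (g u)) \<le> (1 + y) ^ card M * exp (g a)"
      if "finite M" "a \<notin> M" "\<And>u. u \<in> M \<Longrightarrow> {a, u} \<in> F" for a M
      using that by (rule prod)
  qed (use U finF y0 s g in auto)
  also have "\<dots> = (1 + y) ^ card R * exp (g v)"
    using R finF by (simp add: card_Diff_subset card_mono flip: power_add)
  also have "(1 + y) ^ card R = exp m"
    using cR unfolding y_def x by (simp flip: exp_of_nat_mult)
  finally have sets: "(\<Sum>S\<in>Pow R. y ^ card S * exp s ^ ?X S) \<le> exp m * exp (g v)" .
  have "measure_pmf.expectation ?p (\<lambda>es. exp s ^ ?X (set es)) \<le>
      fact m / x ^ m * (\<Sum>S\<in>Pow R. y ^ card S * exp s ^ ?X S) / card R ^ m"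
    unfolding expectation_replicate_pmf_of_set[OF R(1,2)] y_def
    using sum_lists_le_sum_sets[OF R(1) x0, of "\<lambda>S. exp s ^ ?X S" m]
    by (intro divide_right_mono) auto
  also have "\<dots> \<le> fact m / x ^ m * (exp m * exp (g v)) / card R ^ m"
    by (intro divide_right_mono mult_left_mono sets) (use x0 in auto)
  also have "\<dots> = fact m * exp m / m ^ m * exp (g v)"
    using cR m unfolding x by (simp add: power_divide)
  also have "\<dots> \<le> exp 1 * m * exp (g v)"
    using fact_le_exp_bound[OF m] m by (intro mult_right_mono) (auto simp: field_simps)
  finally have E: "measure_pmf.expectation ?p (\<lambda>es. exp s ^ ?X (set es)) \<le> exp 1 * m * exp (g v)" .
  have "measure_pmf.prob ?p {es. t \<le> ?X (set es)} \<le>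
      measure_pmf.prob ?p {es \<in> space ?p. exp (s * t) \<le> exp s ^ ?X (set es)}"
  proof (rule measure_pmf.finite_measure_mono)
    show "{es. t \<le> ?X (set es)} \<subseteq> {es \<in> space ?p. exp (s * t) \<le> exp s ^ ?X (set es)}"
      using s by (auto simp flip: exp_of_nat2_mult intro!: mult_left_mono)
  qed simp
  also have "\<dots> \<le> measure_pmf.expectation ?p (\<lambda>es. exp s ^ ?X (set es)) / exp (s * t)"
    by (rule integral_Markov_inequality_measure[where A = "{}"])
      (use integrable_measure_pmf_finite[OF finite_set_replicate_pmf_of_set[OF R(1,2)]] in auto)
  also have "\<dots> \<le> exp 1 * m * exp (g v) / exp (s * t)"
    using E by (intro divide_right_mono) auto
  also have "\<dots> = exp 1 * m * exp (g v - s * t)" by (simp add: exp_diff)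
  finally show ?thesis .
qed

section \<open>Counting pairs, and the union bound over starting vertices\<close>

lemma finite_all_pairs [simp]: "finite (all_pairs n)"
  unfolding all_pairs_def by simp

lemma card_doubletons:
  assumes "finite A"
  shows "real (card {e. e \<subseteq> A \<and> card e = 2}) = real (card A) * (real (card A) - 1) / 2"
proof -
  have "2 dvd card A * (card A - 1)" by (cases "card A") auto
  then have "2 * card {e. e \<subseteq> A \<and> card e = 2} = card A * (card A - 1)"
    using assms by (simp add: n_subsets choose_two)
  then have "real (2 * card {e. e \<subseteq> A \<and> card e = 2}) = real (card A * (card A - 1))"
    by (rule arg_cong)
  then have "2 * real (card {e. e \<subseteq> A \<and> card e = 2}) = real (card A) * real (card A - 1)"
    by (simp only: of_nat_mult of_nat_numeral)
  then show ?thesis by (cases "card A") auto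
qed

lemma card_all_pairs: "real (card (all_pairs n)) = real n * (real n - 1) / 2"
  unfolding all_pairs_def using card_doubletons[of "{..<n}"] by simp

lemma doubleton_in_all_pairs: "{a, b} \<in> all_pairs n \<longleftrightarrow> a < n \<and> b < n \<and> a \<noteq> b"
  unfolding all_pairs_def by (auto simp: card_2_iff doubleton_eq_iff)

lemma all_pairs_nonempty: "n \<ge> 2 \<Longrightarrow> all_pairs n \<noteq> {}"
  using doubleton_in_all_pairs[of 0 1 n] by auto

text \<open>The threshold \<open>4 / s * ln n\<close> makes each tail of order m / n^4, so that a
  union bound over the \<open>n\<close> starting vertices leaves m / n^3.\<close>

lemma prob_edge_process_large_component:
  fixes g :: "nat \<Rightarrow> real" and s x :: real
  assumes n: "n \<ge> 2" and F: "F \<subseteq> all_pairs n" and m: "m \<ge> 1"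
    and x: "x = real m / card (all_pairs n)"
    and s: "0 < s" "s \<le> 1" and g: "\<And>u. 0 \<le> g u" "\<And>u. g u \<le> 1"
    and sub: "\<And>a M. finite M \<Longrightarrow> a \<notin> M \<Longrightarrow> (\<And>u. u \<in> M \<Longrightarrow> {a, u} \<in> F) \<Longrightarrow>
           (\<Sum>u\<in>M. x * (exp (s + g u) - 1)) \<le> g a"
  shows "measure_pmf.prob (edge_process n m)
      {es. \<exists>v<n. 4 / s * ln n < 1 + real (card (reach (set es \<inter> F) {v} ({..<n} - {v})))}
    \<le> exp 3 * m / real n ^ 3"
proof -
  let ?t = "4 / s * ln n - 1"
  let ?B = "\<lambda>v. {es. ?t \<le> card (reach (set es \<inter> F) {v} ({..<n} - {v}))}"
  have "measure_pmf.prob (edge_process n m)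
      {es. \<exists>v<n. 4 / s * ln n < 1 + real (card (reach (set es \<inter> F) {v} ({..<n} - {v})))}
    \<le> measure_pmf.prob (edge_process n m) (\<Union>v\<in>{..<n}. ?B v)"
    by (rule measure_pmf.finite_measure_mono) auto
  also have "\<dots> \<le> (\<Sum>v<n. measure_pmf.prob (edge_process n m) (?B v))"
    by (rule measure_pmf.finite_measure_subadditive_finite) auto
  also have "\<dots> \<le> (\<Sum>v<n. exp 3 * m / real n ^ 4)"
  proof (rule sum_mono)
    fix v
    have "measure_pmf.prob (edge_process n m) (?B v) \<le> exp 1 * m * exp (g v - s * ?t)"
      unfolding edge_process_def
      by (rule reach_tail[OF finite_all_pairs all_pairs_nonempty[OF n] F m x])
        (use s g sub in auto)
    \<comment> \<open>The 2 absorbs \<open>g v \<le> 1\<close> and the term \<open>s \<le> 1\<close>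
      caused by the start vertex, the \<open>- 1\<close> in \<open>?t\<close>.\<close>
    also have "\<dots> \<le> exp 1 * m * exp (2 - 4 * ln n)"
      using s g(2)[of v] by (intro mult_left_mono) (auto simp: algebra_simps)
    also have "exp (4 * ln n) = real n ^ 4"
      using n exp_of_nat_mult[of 4 "ln n"] by simp
    then have "exp 1 * m * exp (2 - 4 * ln n) = exp 3 * m / real n ^ 4"
      by (simp add: exp_diff mult_exp_exp)
    finally show "measure_pmf.prob (edge_process n m) (?B v) \<le> exp 3 * m / real n ^ 4" .
  qed
  also have "\<dots> = exp 3 * m / real n ^ 3"
    using n by (simp add: power_numeral_reduce)
  finally show ?thesis .
qed

section \<open>Graph components as explored sets\<close>

lemma graph_component_subset_reach:
  assumes "E \<subseteq> all_pairs n" "K \<in> graph_components {..<n} E"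
  shows "\<exists>v<n. K \<subseteq> insert v (reach E {v} ({..<n} - {v}))"
proof -
  obtain v where v: "v < n" "K = connected_in {..<n} E `` {v}"
    using assms(2) unfolding graph_components_def by (auto elim: quotientE)
  \<comment> \<open>A walk may return to \<open>v\<close>, which exploration forbids; each of its
    vertices is then still \<open>v\<close> or a reached vertex.\<close>
  have "y \<in> insert v (reach E {v} ({..<n} - {v}))" if "(v, y) \<in> {(u, v). {u, v} \<in> E}\<^sup>*" for y
    using that
  proof (induction rule: rtrancl_induct)
    case (step y w)
    then have "{y, w} \<in> E" by simp
    moreover from this have "w < n" using assms(1) doubleton_in_all_pairs by blast
    ultimately show ?case
      using step.IH reach_step[of y "{v}" E "{..<n} - {v}" w] by blast
  qed simp
  then show ?thesis using v unfolding connected_in_def by blast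
qed

lemma card_graph_component_le:
  assumes "E \<subseteq> all_pairs n" "K \<in> graph_components {..<n} E"
  shows "\<exists>v<n. card K \<le> 1 + card (reach E {v} ({..<n} - {v}))"
proof -
  obtain v where v: "v < n" "K \<subseteq> insert v (reach E {v} ({..<n} - {v}))"
    using graph_component_subset_reach[OF assms] by auto
  have "card K \<le> card (insert v (reach E {v} ({..<n} - {v})))"
    using v(2) by (intro card_mono) (auto intro: finite_reach)
  also have "\<dots> \<le> 1 + card (reach E {v} ({..<n} - {v}))"
    by (simp add: card_insert_le_m1 card_insert_if finite_reach)
  finally show ?thesis using v(1) by auto
qed

subsection \<open>Isolated vertices\<close>

definition isolated :: "nat \<Rightarrow> edge list \<Rightarrow> nat set" where
  "isolated n es = {v. v < n \<and> v \<notin> \<Union> (set es)}"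

lemma isolated_subset: "isolated n es \<subseteq> {..<n}"
  unfolding isolated_def by auto

lemma integrable_edge_process [simp]:
  fixes f :: "edge list \<Rightarrow> real"
  assumes "n \<ge> 2"
  shows "integrable (measure_pmf (edge_process n m)) f"
  unfolding edge_process_def
  by (rule integrable_measure_pmf_finite[OF finite_set_replicate_pmf_of_set])
    (use all_pairs_nonempty[OF assms] in auto)

text \<open>Every round must independently draw one of the pairs in the complement of
  \<open>W\<close>. Sets \<open>W\<close> of one and two vertices give the first and second moments
  of the number of isolated vertices.\<close>

lemma expectation_avoids:
  assumes n: "n \<ge> 2" and W: "W \<subseteq> {..<n}"
  shows "measure_pmf.expectation (edge_process n m) (\<lambda>es. of_bool (W \<inter> \<Union> (set es) = {})) =
    ((real n - card W) * (real n - card W - 1) / (real n * (real n - 1))) ^ m"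
proof -
  let ?D = "{e. e \<subseteq> {..<n} - W \<and> card e = 2}"
  have finD: "finite ?D" by simp
  have cW: "card W \<le> n" using card_mono[OF _ W] by simp
  have "(\<Sum>es | set es \<subseteq> all_pairs n \<and> length es = m. of_bool (W \<inter> \<Union> (set es) = {}) :: real) =
      (\<Sum>es | set es \<subseteq> ?D \<and> length es = m. 1)"
    by (rule sum.mono_neutral_cong_right)
      (use finite_lists_length_eq[of "all_pairs n" m] in \<open>auto simp: all_pairs_def\<close>)
  also have "\<dots> = real (card ?D) ^ m"
    using card_lists_length_eq[OF finD, of m] by simp
  finally have "measure_pmf.expectation (edge_process n m) (\<lambda>es. of_bool (W \<inter> \<Union> (set es) = {})) =
      (real (card ?D) / card (all_pairs n)) ^ m"
    unfolding edge_process_def expectation_replicate_pmf_of_set[OF finite_all_pairs all_pairs_nonempty[OF n]]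
    by (simp add: power_divide)
  also have "real (card ?D) = (real n - card W) * (real n - card W - 1) / 2"
    using card_doubletons[of "{..<n} - W"] W cW
    by (simp add: card_Diff_subset finite_subset of_nat_diff)
  finally show ?thesis by (simp add: card_all_pairs)
qed

text \<open>Chebyshev's inequality; distinct vertices are negatively correlated.\<close>

lemma prob_few_isolated:
  assumes n: "n \<ge> 3" and \<epsilon>: "\<epsilon> > 0"
  shows "measure_pmf.prob (edge_process n m)
      {es. real (card (isolated n es)) \<le> ((1 - 2 / n) ^ m - \<epsilon>) * n} \<le> 1 / (\<epsilon>\<^sup>2 * n)"
proof -
  let ?P = "edge_process n m"
  define q where "q = (1 - 2 / real n) ^ m"
  define I :: "nat \<Rightarrow> edge list \<Rightarrow> real" where "I v es = of_bool (v \<notin> \<Union> (set es))" for v es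
  have n2: "n \<ge> 2" using n by simp
  note [simp] = integrable_edge_process[OF n2]
  have q: "0 \<le> q" "q \<le> 1" unfolding q_def using n by (auto intro!: power_le_one)
  have E1: "measure_pmf.expectation ?P (I v) = q" if "v < n" for v
  proof -
    have "measure_pmf.expectation ?P (I v) = ((real n - 1) * (real n - 2) / (real n * (real n - 1))) ^ m"
      using expectation_avoids[OF n2, of "{v}" m] that unfolding I_def by simp
    also have "(real n - 1) * (real n - 2) / (real n * (real n - 1)) = 1 - 2 / n"
      using n by (simp add: field_simps)
    finally show ?thesis unfolding q_def .
  qed
  have E2: "measure_pmf.expectation ?P (\<lambda>es. I u es * I v es) \<le> q\<^sup>2" if "u < n" "v < n" "u \<noteq> v" for u v
  proof -
    have "(\<lambda>es. I u es * I v es) = (\<lambda>es. of_bool ({u, v} \<inter> \<Union> (set es) = {}))"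
      unfolding I_def by auto
    then have "measure_pmf.expectation ?P (\<lambda>es. I u es * I v es) =
        ((real n - 2) * (real n - 3) / (real n * (real n - 1))) ^ m"
      using expectation_avoids[OF n2, of "{u, v}" m] that by simp
    also have "\<dots> \<le> ((1 - 2 / n)\<^sup>2) ^ m"
    proof (rule power_mono)
      \<comment> \<open>Negative correlation reduces to n (n - 3) \<le> (n - 1) (n - 2).\<close>
      have "(real n - 2) * (real n - 3) * n\<^sup>2 \<le> (real n - 2)\<^sup>2 * (real n * (real n - 1))"
      proof -
        have "(real n - 2) * real n * ((real n - 3) * n) \<le> (real n - 2) * real n * ((real n - 2) * (real n - 1))"
          using n by (intro mult_left_mono) (auto simp: algebra_simps)
        then show ?thesis by (simp add: power2_eq_square mult_ac)
      qed
      then have "(real n - 2) * (real n - 3) / (real n * (real n - 1)) \<le> (real n - 2)\<^sup>2 / (real n)\<^sup>2"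
        using n by (simp add: divide_simps mult_ac)
      also have "\<dots> = (1 - 2 / n)\<^sup>2"
        using n by (simp add: field_simps)
      finally show "(real n - 2) * (real n - 3) / (real n * (real n - 1)) \<le> (1 - 2 / n)\<^sup>2" .
    qed (use n in auto)
    finally show ?thesis unfolding q_def by (simp add: power_mult[symmetric] mult.commute)
  qed
  \<comment> \<open>Covariances of distinct vertices are at most 0 and variances at most 1, so the
    total variance is at most \<open>n\<close>.\<close>
  have var: "measure_pmf.expectation ?P (\<lambda>es. (I u es - q) * (I v es - q)) \<le> of_bool (u = v)"
    if "u < n" "v < n" for u v
  proof -
    have "(\<lambda>es. (I u es - q) * (I v es - q)) = (\<lambda>es. I u es * I v es - q * I u es - q * I v es + q\<^sup>2)"
      by (auto simp: algebra_simps power2_eq_square)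
    then have *: "measure_pmf.expectation ?P (\<lambda>es. (I u es - q) * (I v es - q)) =
        measure_pmf.expectation ?P (\<lambda>es. I u es * I v es) - q\<^sup>2"
      using E1 that by (simp add: power2_eq_square)
    show ?thesis
    proof (cases "u = v")
      case True
      then have "(\<lambda>es. I u es * I v es) = I v" by (auto simp: I_def fun_eq_iff of_bool_def)
      then have "measure_pmf.expectation ?P (\<lambda>es. (I u es - q) * (I v es - q)) = q - q\<^sup>2"
        using * E1[OF that(2)] by simp
      moreover have "q - q\<^sup>2 \<le> 1" using q(2) zero_le_power2[of q] by linarith
      ultimately show ?thesis using True by simp
    next
      case False
      with * E2 that show ?thesis by simp
    qed
  qed
  have card: "real (card (isolated n es)) = (\<Sum>v<n. I v es)" for es
  proof -
    have "isolated n es = {..<n} \<inter> {v. v \<notin> \<Union> (set es)}" unfolding isolated_def by auto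
    then show ?thesis unfolding I_def by (simp add: sum_of_bool_eq)
  qed
  have dev: "(real (card (isolated n es)) - real n * q)\<^sup>2 = (\<Sum>u<n. \<Sum>v<n. (I u es - q) * (I v es - q))" for es
  proof -
    have "real (card (isolated n es)) - real n * q = (\<Sum>v<n. I v es - q)"
      unfolding card by (simp add: sum_subtractf)
    then show ?thesis by (simp add: power2_eq_square sum_product)
  qed
  have "measure_pmf.expectation ?P (\<lambda>es. (real (card (isolated n es)) - real n * q)\<^sup>2) =
      (\<Sum>u<n. \<Sum>v<n. measure_pmf.expectation ?P (\<lambda>es. (I u es - q) * (I v es - q)))"
    unfolding dev by simp
  also have "\<dots> \<le> (\<Sum>u<n. \<Sum>v<n. of_bool (u = v))"
    by (intro sum_mono var) auto
  also have "\<dots> = n" by (simp add: of_bool_def)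
  finally have V: "measure_pmf.expectation ?P (\<lambda>es. (real (card (isolated n es)) - real n * q)\<^sup>2) \<le> real n" .
  have "measure_pmf.prob ?P {es. real (card (isolated n es)) \<le> (q - \<epsilon>) * n} \<le>
      measure_pmf.prob ?P {es \<in> space ?P. (\<epsilon> * real n)\<^sup>2 \<le> (real (card (isolated n es)) - real n * q)\<^sup>2}"
  proof (rule measure_pmf.finite_measure_mono, safe)
    fix es assume "real (card (isolated n es)) \<le> (q - \<epsilon>) * n"
    then have "\<epsilon> * real n \<le> real n * q - real (card (isolated n es))" by (simp add: algebra_simps)
    then have "(\<epsilon> * real n)\<^sup>2 \<le> (real n * q - real (card (isolated n es)))\<^sup>2"
      using \<epsilon> by (intro power_mono) auto
    then show "(\<epsilon> * real n)\<^sup>2 \<le> (real (card (isolated n es)) - real n * q)\<^sup>2"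
      by (simp add: power2_commute)
  qed auto
  also have "\<dots> \<le> measure_pmf.expectation ?P (\<lambda>es. (real (card (isolated n es)) - real n * q)\<^sup>2) / (\<epsilon> * real n)\<^sup>2"
    by (rule integral_Markov_inequality_measure[where A = "{}"]) (use n \<epsilon> in auto)
  also have "\<dots> \<le> n / (\<epsilon> * real n)\<^sup>2" using V by (intro divide_right_mono) auto
  also have "\<dots> = 1 / (\<epsilon>\<^sup>2 * n)" using n by (simp add: power2_eq_square)
  finally show ?thesis unfolding q_def .
qed

subsection \<open>The two-phase algorithm\<close>

lemma run_Nil [simp]: "run A [] = []"
  unfolding run_def by simp

lemma run_snoc [simp]: "run A (es @ [e]) = run A es @ [(e, A (run A es) e)]"
  unfolding run_def by simp

text \<open>An arbitrary junk set when there are fewer than \<open>k\<close> isolated vertices.\<close>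

definition chosen :: "nat \<Rightarrow> nat \<Rightarrow> edge list \<Rightarrow> nat set" where
  "chosen n k es = (SOME I. I \<subseteq> isolated n es \<and> card I = k)"

lemma chosen:
  assumes "k \<le> card (isolated n es)"
  shows "chosen n k es \<subseteq> isolated n es" "card (chosen n k es) = k"
proof -
  have "\<exists>I. I \<subseteq> isolated n es \<and> card I = k"
    using obtain_subset_with_card_n[OF assms] by blast
  then have "chosen n k es \<subseteq> isolated n es \<and> card (chosen n k es) = k"
    unfolding chosen_def by (rule someI_ex)
  then show "chosen n k es \<subseteq> isolated n es" "card (chosen n k es) = k" by auto
qed

text \<open>The set is recomputed in every round from the first \<open>m\<close> edges of the
  history. From round \<open>m\<close> on these no longer change, so the same set is used throughout
  the second phase.\<close>

definition two_phase :: "nat \<Rightarrow> nat \<Rightarrow> nat \<Rightarrow> online_algorithm" where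
  "two_phase n k m h e =
    (if length h < m \<or> e \<subseteq> chosen n k (map fst (take m h)) then Red else Blue)"

lemma run_two_phase_first:
  "length xs \<le> m \<Longrightarrow> run (two_phase n k m) xs = map (\<lambda>e. (e, Red)) xs"
  by (induction xs rule: rev_induct) (auto simp: two_phase_def)

lemma run_two_phase:
  assumes "length xs = m"
  shows "run (two_phase n k m) (xs @ ys) =
    map (\<lambda>e. (e, Red)) xs @ map (\<lambda>e. (e, if e \<subseteq> chosen n k xs then Red else Blue)) ys"
proof (induction ys rule: rev_induct)
  case Nil
  then show ?case using run_two_phase_first[of xs] assms by simp
next
  case (snoc e ys)
  let ?h = "map (\<lambda>e. (e, Red)) xs @ map (\<lambda>e. (e, if e \<subseteq> chosen n k xs then Red else Blue)) ys"
  have "run (two_phase n k m) (xs @ ys @ [e]) = run (two_phase n k m) ((xs @ ys) @ [e])" by simp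
  also have "\<dots> = ?h @ [(e, two_phase n k m ?h e)]"
    unfolding run_snoc snoc.IH ..
  also have "two_phase n k m ?h e = (if e \<subseteq> chosen n k xs then Red else Blue)"
    using assms by (simp add: two_phase_def comp_def)
  finally show ?case by simp
qed

lemma color_class_two_phase:
  assumes "length xs = m"
  shows "color_class (run (two_phase n k m) (xs @ ys)) c =
    (if c = Red then set xs \<union> {e \<in> set ys. e \<subseteq> chosen n k xs} else {e \<in> set ys. \<not> e \<subseteq> chosen n k xs})"
proof -
  have "{e. (e, c) \<in> set (map (\<lambda>e. (e, f e)) es)} = {e \<in> set es. f e = c}" for f and es :: "edge list"
    by auto
  then have "color_class (run (two_phase n k m) (xs @ ys)) c =
      {e \<in> set xs. Red = c} \<union> {e \<in> set ys. (if e \<subseteq> chosen n k xs then Red else Blue) = c}"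
    unfolding color_class_def run_two_phase[OF assms] set_append Un_iff Collect_disj_eq by simp
  moreover have "(if P then Red else Blue) = c \<longleftrightarrow> (if c = Red then P else \<not> P)" for P
    by (cases c) simp_all
  ultimately show ?thesis by simp
qed

text \<open>
  The vertices of \<open>I\<close> are isolated in \<open>E1\<close> and all edges of \<open>E2\<close> lie inside \<open>I\<close>, so no component
  of the union uses both kinds of edges.
\<close>

lemma reach_separated:
  assumes "I \<inter> \<Union> E1 = {}" "\<Union> E2 \<subseteq> I"
  shows "reach (E1 \<union> E2) {v} U \<subseteq> (if v \<in> I then reach E2 {v} U else reach E1 {v} U)"
proof -
  define E where "E = (if v \<in> I then E2 else E1)"
  have "x \<in> reach E {v} U \<and> (x \<in> I \<longleftrightarrow> v \<in> I)" if "x \<in> reach (E1 \<union> E2) {v} U" for x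
    using that
  proof (induction rule: reach_induct)
    case (step x y)
    then have x: "x \<in> {v} \<union> reach E {v} U" "x \<in> I \<longleftrightarrow> v \<in> I" by auto
    have "x \<notin> I \<and> y \<notin> I" if "{x, y} \<in> E1"
      using that assms(1) by blast
    moreover have "x \<in> I \<and> y \<in> I" if "{x, y} \<in> E2"
      using that assms(2) by blast
    ultimately have "{x, y} \<in> E" "y \<in> I \<longleftrightarrow> v \<in> I"
      using x(2) step(2) unfolding E_def by auto
    with reach_step[OF x(1) _ step(3)] show ?case by simp
  qed
  then show ?thesis unfolding E_def by auto
qed

text \<open>A red component lives in the first-phase graph or in the later graph inside the chosen
  set, and a blue one in the later graph of the remaining pairs. \<open>F\<close> and
  \<open>G\<close> are determined by \<open>xs\<close> alone, so for fixed \<open>xs\<close> each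
  graph can be treated as a fresh edge process restricted to a fixed set of pairs.\<close>

lemma card_component_two_phase:
  fixes t :: real
  assumes xs: "length xs = m" "set xs \<subseteq> all_pairs n" and ys: "set ys \<subseteq> all_pairs n"
    and k: "k \<le> card (isolated n xs)"
    and K: "K \<in> graph_components {..<n} (color_class (run (two_phase n k m) (xs @ ys)) c)"
    and t: "t < card K"
  defines "F \<equiv> {e \<in> all_pairs n. e \<subseteq> chosen n k xs}"
    and "G \<equiv> {e \<in> all_pairs n. \<not> e \<subseteq> chosen n k xs}"
  shows "\<exists>v<n. t < 1 + real (card (reach (set xs \<inter> all_pairs n) {v} ({..<n} - {v}))) \<or>
    t < 1 + real (card (reach (set ys \<inter> F) {v} ({..<n} - {v}))) \<or>
    t < 1 + real (card (reach (set ys \<inter> G) {v} ({..<n} - {v})))"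
proof -
  let ?I = "chosen n k xs"
  have eqs: "set xs \<inter> all_pairs n = set xs" "set ys \<inter> F = {e \<in> set ys. e \<subseteq> ?I}"
    "set ys \<inter> G = {e \<in> set ys. \<not> e \<subseteq> ?I}"
    using xs ys unfolding F_def G_def by auto
  let ?E = "color_class (run (two_phase n k m) (xs @ ys)) c"
  have E: "?E = (if c = Red then set xs \<union> {e \<in> set ys. e \<subseteq> ?I} else {e \<in> set ys. \<not> e \<subseteq> ?I})"
    by (rule color_class_two_phase[OF xs(1)])
  then have "?E \<subseteq> all_pairs n" using xs ys by auto
  from card_graph_component_le[OF this K] obtain v
    where v: "v < n" "card K \<le> 1 + card (reach ?E {v} ({..<n} - {v}))" by auto
  have fin: "finite (reach S {v} ({..<n} - {v}))" for S by (rule finite_reach) simp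
  have sep: "?I \<inter> \<Union> (set xs) = {}" "\<Union> {e \<in> set ys. e \<subseteq> ?I} \<subseteq> ?I"
    using chosen(1)[OF k] unfolding isolated_def by auto
  have "card (reach ?E {v} ({..<n} - {v})) \<le> card (reach (set xs) {v} ({..<n} - {v})) \<or>
      card (reach ?E {v} ({..<n} - {v})) \<le> card (reach {e \<in> set ys. e \<subseteq> ?I} {v} ({..<n} - {v})) \<or>
      card (reach ?E {v} ({..<n} - {v})) \<le> card (reach {e \<in> set ys. \<not> e \<subseteq> ?I} {v} ({..<n} - {v}))"
    using reach_separated[OF sep, of v "{..<n} - {v}"] card_mono[OF fin] unfolding E
    by (cases c) (auto split: if_splits)
  then show ?thesis using v t unfolding eqs by (intro exI[of _ v]) auto
qed

text \<open>A union bound for a two-stage experiment: the conditional probability of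
  \<open>A\<close> is at most 1 on \<open>B\<close> and at most \<open>\<delta>\<close> off
  it.\<close>

lemma prob_bind_pmf_le:
  assumes B: "measure_pmf.prob p B \<le> \<beta>" and "\<delta> \<ge> 0"
    and A: "\<And>x. x \<in> set_pmf p \<Longrightarrow> x \<notin> B \<Longrightarrow> measure_pmf.prob (f x) A \<le> \<delta>"
  shows "measure_pmf.prob (bind_pmf p f) A \<le> \<beta> + \<delta>"
proof -
  have \<beta>: "\<beta> \<ge> 0" using B measure_nonneg order_trans by blast
  have "emeasure (bind_pmf p f) A = (\<integral>\<^sup>+x. emeasure (f x) A \<partial>p)" by simp
  also have "\<dots> \<le> (\<integral>\<^sup>+x. indicator B x + ennreal \<delta> \<partial>p)"
  proof (intro nn_integral_mono_AE AE_pmfI)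
    fix x assume x: "x \<in> set_pmf p"
    show "emeasure (f x) A \<le> indicator B x + ennreal \<delta>"
    proof (cases "x \<in> B")
      case True
      have "emeasure (f x) A \<le> 1" by (rule measure_pmf.emeasure_le_1)
      also have "\<dots> \<le> indicator B x + ennreal \<delta>" using True by simp
      finally show ?thesis .
    next
      case False
      then show ?thesis using A[OF x] assms(2)
        by (simp add: measure_pmf.emeasure_eq_measure ennreal_leI)
    qed
  qed
  also have "\<dots> = emeasure p B + ennreal \<delta>"
    by (simp add: nn_integral_add measure_pmf.emeasure_space_1)
  also have "\<dots> \<le> ennreal (\<beta> + \<delta>)"
    using B \<beta> assms(2) by (simp add: measure_pmf.emeasure_eq_measure ennreal_leI flip: ennreal_plus)
  finally show ?thesis
    unfolding measure_pmf.emeasure_eq_measure using \<beta> assms(2) by (subst (asm) ennreal_le_iff) auto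
qed

text \<open>
  The weights are \<open>\<theta>\<close> times an approximate Perron eigenvector of the two-type kernel, of spectral
  radius below 1, so that the exploration inequality holds to first order in \<open>\<theta>\<close>; the choice
  \<open>\<sigma> = \<theta>\<^sup>2\<close> only contributes to second order.
\<close>

definition \<theta> :: real where "\<theta> = 1 / 10 ^ 6"

definition \<sigma> :: real where "\<sigma> = 1 / 10 ^ 12"

text \<open>By exp t \<le> 1 + t + t^2 on [0, 1], the excess over the linear term in
  \<open>\<theta>\<close> is of order \<open>\<theta>\<^sup>2\<close>, which the last digit of each
  constant absorbs.\<close>

lemma exp_weight_bounds:
  "exp (\<sigma> + \<theta>) - 1 \<le> 1.00001 * \<theta>" "exp (\<sigma> + 0.7082 * \<theta>) - 1 \<le> 0.70821 * \<theta>"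
proof -
  have "exp (\<sigma> + \<theta>) \<le> 1 + (\<sigma> + \<theta>) + (\<sigma> + \<theta>)\<^sup>2"
    by (rule exp_bound) (auto simp: \<sigma>_def \<theta>_def)
  also have "\<dots> \<le> 1 + 1.00001 * \<theta>"
    by (simp add: \<sigma>_def \<theta>_def power2_eq_square)
  finally show "exp (\<sigma> + \<theta>) - 1 \<le> 1.00001 * \<theta>" by simp
  have "exp (\<sigma> + 0.7082 * \<theta>) \<le> 1 + (\<sigma> + 0.7082 * \<theta>) + (\<sigma> + 0.7082 * \<theta>)\<^sup>2"
    by (rule exp_bound) (auto simp: \<sigma>_def \<theta>_def)
  also have "\<dots> \<le> 1 + 0.70821 * \<theta>"
    by (simp add: \<sigma>_def \<theta>_def power2_eq_square)
  finally show "exp (\<sigma> + 0.7082 * \<theta>) - 1 \<le> 0.70821 * \<theta>" by simp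
qed

section \<open>Tail bounds for the one-type and the two-type graph\<close>

lemma \<theta>_pos: "\<theta> > 0" and \<theta>_le_1: "\<theta> \<le> 1" and \<sigma>_pos: "\<sigma> > 0" and \<sigma>_le_1: "\<sigma> \<le> 1"
  by (auto simp: \<theta>_def \<sigma>_def)

text \<open>One type of vertex, so a constant weight suffices: the mean degree bound 0.99991 times
  the exponential correction 1.00001 is still below 1. It serves the first phase with
  \<open>I\<close> the whole vertex set, and the later red edges with \<open>I\<close> the chosen
  set.\<close>

lemma prob_large_component_inside:
  assumes n: "n \<ge> 2" and m: "m \<ge> 1" and F: "F \<subseteq> {e \<in> all_pairs n. e \<subseteq> I}" and I: "finite I"
    and deg: "real m / card (all_pairs n) * card I \<le> 0.99991"
  shows "measure_pmf.prob (edge_process n m)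
      {es. \<exists>v<n. 4 / \<sigma> * ln n < 1 + real (card (reach (set es \<inter> F) {v} ({..<n} - {v})))}
    \<le> exp 3 * m / real n ^ 3"
proof (rule prob_edge_process_large_component[where g = "\<lambda>_. \<theta>"])
  fix a M assume M: "finite M" "a \<notin> M" "\<And>u. u \<in> M \<Longrightarrow> {a, u} \<in> F"
  have e: "exp (\<sigma> + \<theta>) - 1 \<ge> 0" using \<sigma>_pos \<theta>_pos by simp
  have "M \<subseteq> I" using M(3) F by auto
  then have "real (card M) \<le> card I" using I card_mono by auto
  have "(\<Sum>u\<in>M. real m / card (all_pairs n) * (exp (\<sigma> + \<theta>) - 1)) =
      real m / card (all_pairs n) * card M * (exp (\<sigma> + \<theta>) - 1)" by simp
  also have "\<dots> \<le> real m / card (all_pairs n) * card I * (exp (\<sigma> + \<theta>) - 1)"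
    by (intro mult_right_mono mult_left_mono) (use e \<open>real (card M) \<le> card I\<close> in auto)
  also have "\<dots> \<le> 0.99991 * (1.00001 * \<theta>)"
    by (intro mult_mono deg exp_weight_bounds) (use e in auto)
  also have "\<dots> \<le> \<theta>" using \<theta>_pos by simp
  finally show "(\<Sum>u\<in>M. real m / card (all_pairs n) * (exp (\<sigma> + \<theta>) - 1)) \<le> \<theta>" .
qed (use n m F \<theta>_pos \<theta>_le_1 \<sigma>_pos \<sigma>_le_1 in auto)

lemma prob_large_component_outside:
  assumes n: "n \<ge> 2" and m: "m \<ge> 1" and I: "I \<subseteq> {..<n}"
    and F: "F = {e \<in> all_pairs n. \<not> e \<subseteq> I}"
    and deg1: "real m / card (all_pairs n) * card I \<le> 0.411977"
    and deg2: "real m / card (all_pairs n) * (real n - card I) \<le> 0.708145"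
  shows "measure_pmf.prob (edge_process n m)
      {es. \<exists>v<n. 4 / \<sigma> * ln n < 1 + real (card (reach (set es \<inter> F) {v} ({..<n} - {v})))}
    \<le> exp 3 * m / real n ^ 3"
\<comment> \<open>Vertices of \<open>I\<close> have neighbours outside \<open>I\<close> only, so
  their relative weight has to be at least 0.708145 * 1.00001, hence 0.7082. For the others the two
  contributions are about 0.70815 and 0.29177, together below 1.\<close>
proof (rule prob_edge_process_large_component[where g = "\<lambda>u. if u \<in> I then 0.7082 * \<theta> else \<theta>"])
  let ?x = "real m / card (all_pairs n)"
  let ?g = "\<lambda>u. if u \<in> I then 0.7082 * \<theta> else \<theta>"
  fix a M assume M: "finite M" "a \<notin> M" "\<And>u. u \<in> M \<Longrightarrow> {a, u} \<in> F"
  have e: "exp (\<sigma> + \<theta>) - 1 \<ge> 0" "exp (\<sigma> + 0.7082 * \<theta>) - 1 \<ge> 0"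
    using \<sigma>_pos \<theta>_pos by auto
  have finI: "finite I" using I finite_subset by blast
  have Mn: "M \<subseteq> {..<n}" using M(3) F doubleton_in_all_pairs by auto
  have "real (card ({..<n} - I)) = real n - card I"
    using I finI card_mono[OF _ I] by (simp add: card_Diff_subset of_nat_diff)
  then have out: "(\<Sum>u\<in>{..<n} - I. ?x * (exp (\<sigma> + ?g u) - 1)) \<le> 0.708145 * (1.00001 * \<theta>)"
    using mult_mono[OF deg2 exp_weight_bounds(1)] e by (simp add: mult_ac)
  have nonneg: "0 \<le> ?x * (exp (\<sigma> + ?g u) - 1)" for u
    using e by simp
  show "(\<Sum>u\<in>M. ?x * (exp (\<sigma> + ?g u) - 1)) \<le> ?g a"
  proof (cases "a \<in> I")
    case True
    then have "M \<subseteq> {..<n} - I" using M(3) Mn F by auto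
    then have "(\<Sum>u\<in>M. ?x * (exp (\<sigma> + ?g u) - 1)) \<le> (\<Sum>u\<in>{..<n} - I. ?x * (exp (\<sigma> + ?g u) - 1))"
      by (intro sum_mono2 nonneg) auto
    also note out
    also have "0.708145 * (1.00001 * \<theta>) \<le> 0.7082 * \<theta>" using \<theta>_pos by simp
    finally show ?thesis using True by simp
  next
    case False
    have "(\<Sum>u\<in>M. ?x * (exp (\<sigma> + ?g u) - 1)) \<le> (\<Sum>u<n. ?x * (exp (\<sigma> + ?g u) - 1))"
      by (intro sum_mono2 nonneg Mn) auto
    also have "\<dots> = (\<Sum>u\<in>{..<n} - I. ?x * (exp (\<sigma> + ?g u) - 1)) + (\<Sum>u\<in>I. ?x * (exp (\<sigma> + ?g u) - 1))"
      by (rule sum.subset_diff[OF I]) simp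
    also have "(\<Sum>u\<in>I. ?x * (exp (\<sigma> + ?g u) - 1)) = ?x * card I * (exp (\<sigma> + 0.7082 * \<theta>) - 1)"
      by simp
    also have "\<dots> \<le> 0.411977 * (0.70821 * \<theta>)"
      by (intro mult_mono deg1 exp_weight_bounds) (use e in auto)
    also note out
    also have "0.708145 * (1.00001 * \<theta>) + 0.411977 * (0.70821 * \<theta>) \<le> \<theta>" using \<theta>_pos by simp
    finally show ?thesis using False by simp
  qed
qed (use n m F \<theta>_pos \<theta>_le_1 \<sigma>_pos \<sigma>_le_1 in auto)

text \<open>Since 1 - 2/n is the reciprocal of 1 + 2/(n-2), the power is at least exp(-2m/(n-2)). As
  2m \<le> 0.9999 n \<le> n - 2, this is at least 1/e, which exceeds 0.36785.\<close>

lemma isolated_fraction_bound: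
  assumes n: "n \<ge> 10 ^ 7" and m: "real m \<le> 0.49995 * n"
  shows "(1 - 2 / real n) ^ m \<ge> 0.36785"
proof -
  have n': "real n \<ge> 10 ^ 7" using n by (metis of_nat_le_iff of_nat_numeral of_nat_power)
  have "1 - 2 / real n \<ge> exp (- (2 / (real n - 2)))"
  proof -
    have "1 + 2 / (real n - 2) \<le> exp (2 / (real n - 2))" by (rule exp_ge_add_one_self)
    then have "1 / exp (2 / (real n - 2)) \<le> 1 / (1 + 2 / (real n - 2))"
      using n' by (intro divide_left_mono) (auto intro!: mult_pos_pos add_pos_pos)
    also have "\<dots> = 1 - 2 / real n" using n' by (simp add: field_simps)
    finally show ?thesis by (simp add: exp_minus divide_inverse)
  qed
  then have "(1 - 2 / real n) ^ m \<ge> exp (- (2 / (real n - 2))) ^ m"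
    by (intro power_mono) auto
  also have "exp (- (2 / (real n - 2))) ^ m = exp (- (2 * m / (real n - 2)))"
    by (simp flip: exp_of_nat_mult)
  finally have 1: "(1 - 2 / real n) ^ m \<ge> exp (- (2 * m / (real n - 2)))" .
  have "2 * m / (real n - 2) \<le> 1" using n' m by (simp add: field_simps)
  then have "exp (- (2 * m / (real n - 2))) \<ge> exp (-1)" by simp
  moreover have "exp (-1) \<ge> (0.36785 :: real)"
  proof -
    have "exp 1 \<le> (2.7183 :: real)" using abs_le_D1[OF e_approx_32] by simp
    then have "1 / exp 1 \<ge> (1 / 2.7183 :: real)" by (intro divide_left_mono) auto
    moreover have "exp (-1) = 1 / exp (1 :: real)"
      by (simp only: exp_minus inverse_eq_divide)
    ultimately show ?thesis by simp
  qed
  ultimately show ?thesis using 1 by linarith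
qed

section \<open>Combining the two phases\<close>

lemma prob_two_phase_bad:
  fixes n :: nat
  assumes n: "n \<ge> 10 ^ 7"
  defines "M \<equiv> nat \<lfloor>1.06 * real n\<rfloor>" and "m \<equiv> nat \<lfloor>0.49995 * real n\<rfloor>" and "k \<equiv> nat \<lfloor>0.3678 * real n\<rfloor>"
  shows "measure_pmf.prob (edge_process n M)
      {es. \<exists>c. \<exists>K \<in> graph_components {..<n} (color_class (run (two_phase n k m) es) c).
         4 / \<sigma> * ln n < card K} \<le> (1 / 0.00005\<^sup>2 + 6 * exp 3) / n"
    (is "measure_pmf.prob _ ?Bad \<le> _")
proof -
  define m' where "m' = M - m"
  let ?N = "real (card (all_pairs n))"
  let ?t = "4 / \<sigma> * ln (real n)"
  let ?large = "\<lambda>F. {es. \<exists>v<n. ?t < 1 + real (card (reach (set es \<inter> F) {v} ({..<n} - {v})))}"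
  \<comment> \<open>The slack 0.00005 is 0.36785 - 0.3678, so outside this event at least
    \<open>k\<close> vertices are isolated after the first phase.\<close>
  let ?few = "{es. real (card (isolated n es)) \<le> ((1 - 2 / real n) ^ m - 0.00005) * n}"
  have n': "real n \<ge> 10000000" using n by simp
  then have n2: "n \<ge> 2" and n3: "n \<ge> 3" by auto
  have floor: "real (nat \<lfloor>c * real n\<rfloor>) \<le> c * real n" "real (nat \<lfloor>c * real n\<rfloor>) > c * real n - 1"
    if "c \<ge> 0" for c
    using that by (simp_all add: of_nat_nat)
  have m: "real m \<le> 0.49995 * n" "real m > 0.49995 * n - 1"
    unfolding m_def by (rule floor, simp)+
  have M: "real M \<le> 1.06 * n" "real M > 1.06 * n - 1"
    unfolding M_def by (rule floor, simp)+
  have k: "real k \<le> 0.3678 * n" "real k > 0.3678 * n - 1"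
    unfolding k_def by (rule floor, simp)+
  have "real m \<le> real M" using m(1) M(2) n' by simp
  then have "m \<le> M" by simp
  then have m': "real m' = real M - real m" and Mm: "M = m + m'"
    unfolding m'_def by (auto simp: of_nat_diff)
  have m'_le: "real m' \<le> 0.56005 * n + 1" and m'_gt: "real m' > 0.56005 * n - 1"
    using m' m M n' by auto
  have "real m \<ge> 1" "real m' \<ge> 1" using m m'_gt n' by simp_all
  then have m1: "m \<ge> 1" and m'1: "m' \<ge> 1" by simp_all
  have N: "?N = real n * (real n - 1) / 2" by (rule card_all_pairs)
  have N0: "?N > 0" unfolding N using n' by simp
  \<comment> \<open>The bounds 0.99991 here and 1.12011 below exceed 2 * 0.49995 and 2 * 0.56005
    slightly, to cover rounding and the denominator n - 1 in place of n.\<close>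
  have deg: "real m / ?N * n \<le> 0.99991"
  proof -
    have "real m / ?N * n = 2 * m / (real n - 1)" unfolding N using n' by simp
    also have "\<dots> \<le> 0.99991" using m n' by (simp add: divide_simps)
    finally show ?thesis .
  qed
  have deg': "real m' / ?N * n \<le> 1.12011"
  proof -
    have "real m' / ?N * n = 2 * m' / (real n - 1)" unfolding N using n' by simp
    also have "\<dots> \<le> 1.12011" using m'_le n' by (simp add: divide_simps)
    finally show ?thesis .
  qed
  have deg1: "real m' / ?N * k \<le> 0.411977"
  proof -
    have "real m' / ?N * k \<le> real m' / ?N * (0.3678 * n)"
      by (intro mult_left_mono k) simp
    also have "\<dots> = 0.3678 * (real m' / ?N * n)" by simp
    also have "\<dots> \<le> 0.3678 * 1.12011" by (intro mult_left_mono deg') simp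
    also have "\<dots> \<le> 0.411977" by simp
    finally show ?thesis .
  qed
  have deg2: "real m' / ?N * (real n - k) \<le> 0.708145"
  proof -
    \<comment> \<open>0.63221 is 1 - 0.3678 plus room for rounding \<open>k\<close> down.\<close>
    have "real m' / ?N * (real n - k) \<le> real m' / ?N * (0.63221 * n)"
      by (intro mult_left_mono) (use k n' in auto)
    also have "\<dots> = 0.63221 * (real m' / ?N * n)" by simp
    also have "\<dots> \<le> 0.63221 * 1.12011" by (intro mult_left_mono deg') simp
    also have "\<dots> \<le> 0.708145" by simp
    finally show ?thesis .
  qed
  have small: "exp 3 * real j / real n ^ 3 \<le> 2 * exp 3 / n" if "real j \<le> 2 * n" for j
  proof -
    have "exp 3 * real j / real n ^ 3 \<le> exp 3 * (2 * real n) / real n ^ 3"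
      using that by (intro divide_right_mono mult_left_mono) auto
    also have "\<dots> = 2 * exp 3 / (real n * real n)" using n' by (simp add: power3_eq_cube)
    also have "\<dots> \<le> 2 * exp 3 / n"
      using n' by (intro divide_left_mono) auto
    finally show ?thesis .
  qed
  have P1: "measure_pmf.prob (edge_process n m) (?few \<union> ?large (all_pairs n)) \<le>
      1 / (0.00005\<^sup>2 * n) + 2 * exp 3 / n"
  proof -
    have "measure_pmf.prob (edge_process n m) (?few \<union> ?large (all_pairs n)) \<le>
        measure_pmf.prob (edge_process n m) ?few + measure_pmf.prob (edge_process n m) (?large (all_pairs n))"
      by (rule measure_Un_le) auto
    also have "\<dots> \<le> 1 / (0.00005\<^sup>2 * n) + exp 3 * m / real n ^ 3"
    proof (intro add_mono)
      show "measure_pmf.prob (edge_process n m) ?few \<le> 1 / (0.00005\<^sup>2 * n)"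
        by (rule prob_few_isolated[OF n3]) simp
      show "measure_pmf.prob (edge_process n m) (?large (all_pairs n)) \<le> exp 3 * m / real n ^ 3"
        by (rule prob_large_component_inside[OF n2 m1, where I = "{..<n}"])
          (use deg in \<open>auto simp: all_pairs_def\<close>)
    qed
    also have "exp 3 * m / real n ^ 3 \<le> 2 * exp 3 / n"
      by (rule small) (use m n' in auto)
    finally show ?thesis by simp
  qed
  \<comment> \<open>For a fixed good first phase \<open>xs\<close> the chosen set is constant, and
    the remaining \<open>m'\<close> edges are a fresh edge process.\<close>
  have P2: "measure_pmf.prob (map_pmf ((@) xs) (edge_process n m')) ?Bad \<le> 4 * exp 3 / n"
    if xs: "xs \<in> set_pmf (edge_process n m)" and good: "xs \<notin> ?few \<union> ?large (all_pairs n)" for xs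
  proof -
    let ?I = "chosen n k xs"
    let ?F = "{e \<in> all_pairs n. e \<subseteq> ?I}" and ?G = "{e \<in> all_pairs n. \<not> e \<subseteq> ?I}"
    have support: "length ys = j \<and> set ys \<subseteq> all_pairs n" if "ys \<in> set_pmf (edge_process n j)" for ys j
      using that all_pairs_nonempty[OF n2]
      by (auto simp: edge_process_def set_replicate_pmf lists_eq_set)
    have "0.3678 * real n \<le> ((1 - 2 / real n) ^ m - 0.00005) * n"
      using isolated_fraction_bound[OF n m(1)] by (intro mult_right_mono) auto
    also have "\<dots> < card (isolated n xs)" using good by auto
    finally have kI: "k \<le> card (isolated n xs)" using k by linarith
    have cI: "card ?I = k" "?I \<subseteq> {..<n}"
      using chosen[OF kI] isolated_subset by auto
    have degI: "real m' / ?N * card ?I \<le> 0.99991"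
      unfolding cI(1) by (rule order_trans[OF deg1]) simp
    have finI: "finite ?I" using cI(2) finite_subset by blast
    have "measure_pmf.prob (map_pmf ((@) xs) (edge_process n m')) ?Bad =
        measure_pmf.prob (edge_process n m') {ys. xs @ ys \<in> ?Bad}"
      by (simp add: vimage_def)
    also have "\<dots> \<le> measure_pmf.prob (edge_process n m') (?large ?F \<union> ?large ?G)"
    proof (rule measure_pmf.finite_measure_mono_AE)
      show "AE ys in edge_process n m'. ys \<in> {ys. xs @ ys \<in> ?Bad} \<longrightarrow> ys \<in> ?large ?F \<union> ?large ?G"
      proof (intro AE_pmfI impI)
        fix ys assume ys: "ys \<in> set_pmf (edge_process n m')" and "ys \<in> {ys. xs @ ys \<in> ?Bad}"
        then obtain c K where K: "K \<in> graph_components {..<n} (color_class (run (two_phase n k m) (xs @ ys)) c)"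
          "?t < card K" by auto
        from card_component_two_phase[OF _ _ _ kI K] support[OF xs] support[OF ys] good
        show "ys \<in> ?large ?F \<union> ?large ?G" by blast
      qed
    qed simp
    also have "\<dots> \<le> measure_pmf.prob (edge_process n m') (?large ?F) + measure_pmf.prob (edge_process n m') (?large ?G)"
      by (rule measure_Un_le) auto
    also have "\<dots> \<le> exp 3 * m' / real n ^ 3 + exp 3 * m' / real n ^ 3"
    proof (intro add_mono)
      show "measure_pmf.prob (edge_process n m') (?large ?F) \<le> exp 3 * m' / real n ^ 3"
        by (rule prob_large_component_inside[OF n2 m'1, where I = ?I]) (use degI finI in auto)
      show "measure_pmf.prob (edge_process n m') (?large ?G) \<le> exp 3 * m' / real n ^ 3"
        by (rule prob_large_component_outside[OF n2 m'1 cI(2) refl]) (use deg1 deg2 cI in auto)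
    qed
    also have "\<dots> \<le> 2 * exp 3 / n + 2 * exp 3 / n"
      by (intro add_mono small) (use m'_le n' in auto)
    finally show ?thesis by simp
  qed
  \<comment> \<open>Independence of the rounds splits the process into its two phases. The term of
    order 1/n from Chebyshev's inequality adds to one large-component event in the first phase and
    two in the second.\<close>
  have "edge_process n M = edge_process n m \<bind> (\<lambda>xs. map_pmf ((@) xs) (edge_process n m'))"
    unfolding Mm edge_process_def replicate_pmf_distrib map_pmf_def ..
  then have "measure_pmf.prob (edge_process n M) ?Bad \<le>
      (1 / (0.00005\<^sup>2 * n) + 2 * exp 3 / n) + 4 * exp 3 / n"
    using prob_bind_pmf_le[OF P1 _ P2] by simp
  also have "\<dots> = (1 / 0.00005\<^sup>2 + 6 * exp 3) / n"
    by (simp add: add_divide_distrib)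
  finally show ?thesis .
qed

theorem theorem1p3:
  "\<exists>(A :: nat \<Rightarrow> online_algorithm) (C :: real).
     (\<lambda>n. measure_pmf.prob (edge_process n (nat \<lfloor>1.06 * real n\<rfloor>))
            {es. \<forall>c. \<forall>K \<in> graph_components {..<n} (color_class (run (A n) es) c).
                   real (card K) \<le> C * ln (real n)})
       \<longlonglongrightarrow> 1"
proof -
  \<comment> \<open>The algorithm may depend on \<open>n\<close>; the witness for \<open>C\<close>
    is \<open>4 / \<sigma>\<close>, the constant of the tail bounds.\<close>
  define A :: "nat \<Rightarrow> online_algorithm" where
    "A n = two_phase n (nat \<lfloor>0.3678 * real n\<rfloor>) (nat \<lfloor>0.49995 * real n\<rfloor>)" for n
  let ?P = "\<lambda>n. edge_process n (nat \<lfloor>1.06 * real n\<rfloor>)"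
  let ?good = "\<lambda>n. {es. \<forall>c. \<forall>K \<in> graph_components {..<n} (color_class (run (A n) es) c).
                   real (card K) \<le> 4 / \<sigma> * ln (real n)}"
  let ?D = "1 / 0.00005\<^sup>2 + 6 * exp 3 :: real"
  have "(\<lambda>n. measure_pmf.prob (?P n) (?good n)) \<longlonglongrightarrow> 1"
  proof (rule tendsto_sandwich)
    show "eventually (\<lambda>n. 1 - ?D / n \<le> measure_pmf.prob (?P n) (?good n)) sequentially"
    proof (rule eventually_sequentiallyI)
      fix n :: nat assume n: "10 ^ 7 \<le> n"
      let ?bad = "{es. \<exists>c. \<exists>K \<in> graph_components {..<n} (color_class (run (A n) es) c).
         4 / \<sigma> * ln n < card K}"
      have "?good n = space (measure_pmf (?P n)) - ?bad" by (force simp: not_less)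
      then have "measure_pmf.prob (?P n) (?good n) = 1 - measure_pmf.prob (?P n) ?bad"
        using measure_pmf.prob_compl[of ?bad "?P n"] by simp
      with prob_two_phase_bad[OF n] show "1 - ?D / n \<le> measure_pmf.prob (?P n) (?good n)"
        unfolding A_def by linarith
    qed
    show "(\<lambda>n. 1 - ?D / real n) \<longlonglongrightarrow> 1"
      using tendsto_diff[OF tendsto_const lim_const_over_n[of ?D], of 1] by simp
  qed auto
  then show ?thesis by blast
qed

end
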